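(* Let $K$ be a commutative ring, $R$ a $K$-algebra, $(X,\leqslant)$ a finite connected partially ordered set, $A=I(X,R)$ its incidence algebra over $R$, $\mathcal T$ a spanning tree of the graph of $X$, and $C_1,\ldots,C_k$ the fundamental system of cycles associated with $\mathcal T$, where $k$ is the cyclomatic number of the graph of $X$. Let $\psi$ be a multiplicative automorphism of $A$, and let $w(C_i)$ denote the weight of $C_i$ with respect to $\psi$. Then $\psi$ is an inner automorphism of $A$ if and only if $w(C_1)=\cdots=w(C_k)=1$.
   Context: All rings are associative with a nonzero identity element. The graph of a finite partially ordered set $X$ is the simple graph with vertex set $X$ in which two distinct elements are joined by an edge iff they are comparable (all comparable pairs, not only covering pairs); $X$ is connected if this graph is connected. The incidence algebra is $I(X,R)=\{f\colon X\times X\to R \mid f(x,y)=0 \text{ if } x\not\leqslant y\}$ with pointwise addition and $K$-action and product $(fg)(x,y)=\sum_{x\leqslant z\leqslant y}f(x,z)g(z,y)$; it is a $K$-algebra. Put $A=I(X,R)$, $L=\{f\in A\mid f(x,y)=0 \text{ if } x\neq y\}$ (a subring) and $M=\{f\in A\mid f(x,x)=0 \text{ for all } x\in X\}$ (an ideal), so $A=L\oplus M$ as $K$-modules. For $x<y$ in $X$, $e_{xy}\in A$ is the function with $e_{xy}(x,y)=1$ and value $0$ on all other pairs. A $K$-algebra automorphism $\varphi$ of $A$ is multiplicative if $\varphi(a+c)=a+\beta(c)$ for all $a\in L$, $c\in M$, for some map $\beta\colon M\to M$. An automorphism is inner if it has the form $a\mapsto v^{-1}av$ for an invertible $v\in A$.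 For each multiplicative automorphism $\psi$ there is a unique system of invertible central elements $c_{xy}$ of $R$ ($x,y\in X$, $x<y$) such that $\psi(re_{xy})=c_{xy}re_{xy}$ for all $r\in R$ and $x<y$. The weight of an oriented edge with respect to $\psi$ is $w(x,y)=c_{xy}$ if $x<y$ and $w(x,y)=c_{yx}^{-1}$ if $x>y$. The weight of a semi-path (a walk in the graph of $X$) $P=z_1z_2\ldots z_{l+1}$ is $w(P)=\prod_{i=1}^{l}w(z_i,z_{i+1})$. The weight $w(C)$ of a simple cycle $C$ is the weight of the closed semi-path going once around $C$ from some vertex of $C$ to itself; it is independent of the starting vertex, and reversing the direction replaces it by its inverse, so the condition $w(C)=1$ is well defined. The fundamental system of cycles associated with $\mathcal T$ consists, for each edge of the graph not in $\mathcal T$, of the unique simple cycle formed by that edge together with edges of $\mathcal T$. *)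

theory Defs
  imports Complex_Main "HOL-Library.FuncSet"
begin

section \<open>Incidence algebras\<close>

typedef (overloaded) ('x :: order, 'r :: zero) incidence =
  "{f :: 'x \<Rightarrow> 'x \<Rightarrow> 'r. \<forall>x y. \<not> x \<le> y \<longrightarrow> f x y = 0}"
  morphisms entry Abs_incidence
  by (rule exI [of _ "\<lambda>_ _. 0"]) simp

setup_lifting type_definition_incidence

lemma incidence_eqI:
  fixes f g :: "('x :: order, 'r :: zero) incidence"
  assumes "\<And>x y. x \<le> y \<Longrightarrow> entry f x y = entry g x y"
  shows "f = g"
  using assms by transfer (metis (no_types, lifting) ext)

instantiation incidence :: ("{finite, order}", ring_1) ring_1
begin

lift_definition zero_incidence :: "('a, 'b) incidence" is "\<lambda>_ _. 0" by simp

lift_definition one_incidence :: "('a, 'b) incidence" is "\<lambda>x y. if x = y then 1 else 0" by simp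

lift_definition plus_incidence :: "('a, 'b) incidence \<Rightarrow> ('a, 'b) incidence \<Rightarrow> ('a, 'b) incidence"
  is "\<lambda>f g x y. f x y + g x y" by simp

lift_definition minus_incidence :: "('a, 'b) incidence \<Rightarrow> ('a, 'b) incidence \<Rightarrow> ('a, 'b) incidence"
  is "\<lambda>f g x y. f x y - g x y" by simp

lift_definition uminus_incidence :: "('a, 'b) incidence \<Rightarrow> ('a, 'b) incidence"
  is "\<lambda>f x y. - f x y" by simp

lift_definition times_incidence :: "('a, 'b) incidence \<Rightarrow> ('a, 'b) incidence \<Rightarrow> ('a, 'b) incidence"
  is "\<lambda>f g x y. \<Sum>z\<in>{x..y}. f x z * g z y"
  by (auto intro!: sum.neutral)

lemma entry_times_UNIV:
  fixes f g :: "('a, 'b) incidence"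
  shows "entry (f * g) x y = (\<Sum>z\<in>UNIV. entry f x z * entry g z y)"
  by transfer (rule sum.mono_neutral_left, auto)

instance
proof
  fix a b c :: "('a, 'b) incidence"
  show "a + b + c = a + (b + c)" by transfer (simp add: add.assoc)
  show "a + b = b + a" by transfer (simp add: add.commute)
  show "0 + a = a" by transfer simp
  show "- a + a = 0" by transfer simp
  show "a - b = a + - b" by transfer simp
  show "a * b * c = a * (b * c)"
  proof (rule incidence_eqI)
    fix x y
    have "entry (a * b * c) x y
        = (\<Sum>z\<in>UNIV. \<Sum>w\<in>UNIV. entry a x w * entry b w z * entry c z y)"
      by (simp add: entry_times_UNIV sum_distrib_right)
    also have "\<dots> = (\<Sum>w\<in>UNIV. \<Sum>z\<in>UNIV. entry a x w * entry b w z * entry c z y)"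
      by (rule sum.swap)
    also have "\<dots> = entry (a * (b * c)) x y"
      by (simp add: entry_times_UNIV sum_distrib_left mult.assoc)
    finally show "entry (a * b * c) x y = entry (a * (b * c)) x y" .
  qed
  show "1 * a = a"
    by (rule incidence_eqI) (simp add: entry_times_UNIV one_incidence.rep_eq if_distrib
      [of "\<lambda>t. t * _"] sum.delta cong: if_cong)
  show "a * 1 = a"
    by (rule incidence_eqI) (simp add: entry_times_UNIV one_incidence.rep_eq if_distrib
      [of "\<lambda>t. _ * t"] sum.delta cong: if_cong)
  show "(a + b) * c = a * c + b * c"
    by (rule incidence_eqI)
      (simp add: entry_times_UNIV plus_incidence.rep_eq distrib_right sum.distrib)
  show "a * (b + c) = a * b + a * c"
    by (rule incidence_eqI)
      (simp add: entry_times_UNIV plus_incidence.rep_eq distrib_left sum.distrib)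
  show "(0 :: ('a, 'b) incidence) \<noteq> 1"
    by transfer (metis zero_neq_one)
qed

end

text \<open>
  A \<open>K\<close>-algebra \<open>R\<close>: unital and associative, not necessarily commutative; the ground ring
  acts through \<open>scale\<close>.
\<close>

locale K_algebra = module scale
  for scale :: "'k :: comm_ring_1 \<Rightarrow> 'r :: ring_1 \<Rightarrow> 'r" +
  assumes scale_mult_left: "scale k (r * s) = scale k r * s"
    and scale_mult_right: "scale k (r * s) = r * scale k s"

text \<open>
  The pointwise action of the ground ring. The case distinction only makes the operation total
  on the type for an arbitrary function \<open>scale\<close>; for a module one has \<open>scale k 0 = 0\<close>.
\<close>

lift_definition inc_scale ::
  "('k \<Rightarrow> 'r \<Rightarrow> 'r) \<Rightarrow> 'k \<Rightarrow> ('x :: order, 'r :: zero) incidence \<Rightarrow> ('x, 'r) incidence"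
  is "\<lambda>scale k f x y. if x \<le> y then scale k (f x y) else 0"
  by simp

lemma K_algebra_incidence:
  fixes scale :: "'k :: comm_ring_1 \<Rightarrow> 'r :: ring_1 \<Rightarrow> 'r"
  assumes "K_algebra scale"
  shows "K_algebra (inc_scale scale ::
    'k \<Rightarrow> ('x :: {finite, order}, 'r) incidence \<Rightarrow> ('x, 'r) incidence)"
proof -
  interpret K_algebra scale by fact
  have entry: "entry (inc_scale scale k f) x y = scale k (entry f x y)"
    for k and f :: "('x, 'r) incidence" and x y
    using entry [of f] by (auto simp: inc_scale.rep_eq)
  show ?thesis
    by unfold_locales
      (auto intro!: incidence_eqI simp: entry entry_times_UNIV plus_incidence.rep_eq
        scale_right_distrib scale_left_distrib scale_sum_right scale_mult_left [symmetric]
        scale_mult_right [symmetric])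
qed

definition diagonal_part :: "('x :: order, 'r :: zero) incidence set" where
  "diagonal_part = {f. \<forall>x y. x \<noteq> y \<longrightarrow> entry f x y = 0}"

definition strict_part :: "('x :: order, 'r :: zero) incidence set" where
  "strict_part = {f. \<forall>x. entry f x x = 0}"

text \<open>
  \<open>inc_single x y r\<close> is the function \<open>r e\<^sub>x\<^sub>y\<close>; it is only meaningful (and only used) for \<open>x \<le> y\<close>.
\<close>

lift_definition inc_single :: "'x \<Rightarrow> 'x \<Rightarrow> 'r \<Rightarrow> ('x :: order, 'r :: zero) incidence"
  is "\<lambda>x y r u v. if u = x \<and> v = y \<and> x \<le> y then r else 0"
  by auto


section \<open>Units, centre and automorphisms\<close>

definition inverse_pair :: "'a :: ring_1 \<Rightarrow> 'a \<Rightarrow> bool" where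
  "inverse_pair u v \<longleftrightarrow> u * v = 1 \<and> v * u = 1"

definition invertible_elt :: "'a :: ring_1 \<Rightarrow> bool" where
  "invertible_elt v \<longleftrightarrow> (\<exists>u. inverse_pair u v)"

definition ring_inverse :: "'a :: ring_1 \<Rightarrow> 'a" where
  "ring_inverse v = (THE u. inverse_pair u v)"

definition central_elt :: "'a :: ring_1 \<Rightarrow> bool" where
  "central_elt c \<longleftrightarrow> (\<forall>r. c * r = r * c)"

definition algebra_automorphism ::
  "('k :: comm_ring_1 \<Rightarrow> 'a :: ring_1 \<Rightarrow> 'a) \<Rightarrow> ('a \<Rightarrow> 'a) \<Rightarrow> bool" where
  "algebra_automorphism scale \<phi> \<longleftrightarrow>
     module_hom scale scale \<phi> \<and> bij \<phi> \<and> \<phi> 1 = 1 \<and> (\<forall>a b. \<phi> (a * b) = \<phi> a * \<phi> b)"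

definition inner_automorphism :: "('a :: ring_1 \<Rightarrow> 'a) \<Rightarrow> bool" where
  "inner_automorphism \<phi> \<longleftrightarrow>
     (\<exists>v. invertible_elt v \<and> (\<forall>a. \<phi> a = ring_inverse v * a * v))"

definition multiplicative_automorphism ::
  "('k :: comm_ring_1 \<Rightarrow> 'r :: ring_1 \<Rightarrow> 'r) \<Rightarrow>
   (('x :: {finite, order}, 'r) incidence \<Rightarrow> ('x, 'r) incidence) \<Rightarrow> bool" where
  "multiplicative_automorphism scale \<phi> \<longleftrightarrow>
     algebra_automorphism (inc_scale scale) \<phi> \<and>
     (\<exists>\<beta> \<in> strict_part \<rightarrow> strict_part.
        \<forall>a \<in> diagonal_part. \<forall>c \<in> strict_part. \<phi> (a + c) = a + \<beta> c)"


section \<open>Simple graphs\<close>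

text \<open>
  A simple graph is given by its vertex set \<open>V\<close> and a set \<open>E\<close> of two-element subsets of \<open>V\<close>.
\<close>

definition comparability_edges :: "'x :: order set set" where
  "comparability_edges = {{x, y} |x y. x < y}"

definition walk :: "'v set \<Rightarrow> 'v set set \<Rightarrow> 'v list \<Rightarrow> bool" where
  "walk V E zs \<longleftrightarrow> zs \<noteq> [] \<and> set zs \<subseteq> V \<and> successively (\<lambda>u v. {u, v} \<in> E) zs"

definition walk_edges :: "'v list \<Rightarrow> 'v set set" where
  "walk_edges zs = set (map2 (\<lambda>u v. {u, v}) zs (tl zs))"

definition joined :: "'v set \<Rightarrow> 'v set set \<Rightarrow> 'v \<Rightarrow> 'v \<Rightarrow> bool" where
  "joined V E u v \<longleftrightarrow> (\<exists>zs. walk V E zs \<and> hd zs = u \<and> last zs = v)"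

definition connected_graph :: "'v set \<Rightarrow> 'v set set \<Rightarrow> bool" where
  "connected_graph V E \<longleftrightarrow> V \<noteq> {} \<and> (\<forall>u \<in> V. \<forall>v \<in> V. joined V E u v)"

definition num_components :: "'v set \<Rightarrow> 'v set set \<Rightarrow> nat" where
  "num_components V E = card (V // {(u, v). u \<in> V \<and> v \<in> V \<and> joined V E u v})"

definition cyclomatic_number :: "'v set \<Rightarrow> 'v set set \<Rightarrow> nat" where
  "cyclomatic_number V E = card E + num_components V E - card V"

text \<open>
  A cycle traversal lists its first vertex again at the end; all other vertices are distinct, and
  at least three vertices are visited (going back and forth along an edge is not a cycle). A
  simple cycle is represented by the set of its edges, without a starting vertex or direction.
\<close>

definition cycle_traversal :: "'v set \<Rightarrow> 'v set set \<Rightarrow> 'v list \<Rightarrow> bool" where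
  "cycle_traversal V E zs \<longleftrightarrow>
     walk V E zs \<and> hd zs = last zs \<and> distinct (tl zs) \<and> length zs \<ge> 4"

definition simple_cycle :: "'v set \<Rightarrow> 'v set set \<Rightarrow> 'v set set \<Rightarrow> bool" where
  "simple_cycle V E C \<longleftrightarrow> (\<exists>zs. cycle_traversal V E zs \<and> walk_edges zs = C)"

definition spanning_tree :: "'v set \<Rightarrow> 'v set set \<Rightarrow> 'v set set \<Rightarrow> bool" where
  "spanning_tree V E T \<longleftrightarrow> T \<subseteq> E \<and> connected_graph V T \<and> (\<nexists>C. simple_cycle V T C)"

definition fundamental_cycles :: "'v set \<Rightarrow> 'v set set \<Rightarrow> 'v set set \<Rightarrow> 'v set set set" where
  "fundamental_cycles V E T =
     {C. simple_cycle V E C \<and> (\<exists>e \<in> E - T. e \<in> C \<and> C \<subseteq> insert e T)}"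


section \<open>Weights\<close>

definition mult_coeff ::
  "(('x :: {finite, order}, 'r :: ring_1) incidence \<Rightarrow> ('x, 'r) incidence) \<Rightarrow> 'x \<Rightarrow> 'x \<Rightarrow> 'r" where
  "mult_coeff \<psi> x y =
     (THE c. invertible_elt c \<and> central_elt c \<and>
             (\<forall>r. \<psi> (inc_single x y r) = inc_single x y (c * r)))"

text \<open>
  The description in \<open>mult_coeff_def\<close> is indeed proper: the coefficients exist and are unique.
\<close>

lemma inc_single_mult:
  fixes x y :: "'x :: {finite, order}" and r s :: "'r :: ring_1"
  assumes "x \<le> y"
  shows "inc_single x x s * inc_single x y r = inc_single x y (s * r)"
    and "inc_single x y r * inc_single y y s = inc_single x y (r * s)"
  using assms
  by (auto intro!: incidence_eqI simp: entry_times_UNIV inc_single.rep_eq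
      if_distrib [of "\<lambda>t. t * _"] if_distrib [of "\<lambda>t. _ * t"] cong: if_cong)

lemma inc_single_corner:
  fixes f :: "('x :: {finite, order}, 'r :: ring_1) incidence"
  assumes "x \<le> y"
  shows "inc_single x x 1 * f * inc_single y y 1 = inc_single x y (entry f x y)"
proof (rule incidence_eqI)
  fix u v
  have "entry (inc_single x x 1 * f) u w = (if u = x then entry f x w else 0)" for w
    by (simp add: entry_times_UNIV inc_single.rep_eq
        if_distrib [of "\<lambda>t. t * _"] cong: if_cong)
  then show "entry (inc_single x x 1 * f * inc_single y y 1) u v
      = entry (inc_single x y (entry f x y)) u v"
    using assms by (simp add: entry_times_UNIV [of _ "inc_single y y 1"] inc_single.rep_eq
        if_distrib [of "\<lambda>t. _ * t"] cong: if_cong)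
qed

lemma inc_single_cancel:
  "x \<le> y \<Longrightarrow> inc_single x y r = inc_single x y s \<longleftrightarrow> r = s"
  by (metis (mono_tags, lifting) inc_single.rep_eq)

lemma mult_coeff_unique_exists:
  fixes \<psi> :: "('x :: {finite, order}, 'r :: ring_1) incidence \<Rightarrow> ('x, 'r) incidence"
  assumes \<psi>: "multiplicative_automorphism scale \<psi>" and "x < y"
  shows "\<exists>!c. invertible_elt c \<and> central_elt c \<and>
              (\<forall>r. \<psi> (inc_single x y r) = inc_single x y (c * r))"
proof -
  have xy: "x \<le> y" using \<open>x < y\<close> by simp
  have mult: "\<psi> (a * b) = \<psi> a * \<psi> b" and bij: "bij \<psi>" for a b
    using \<psi> by (auto simp: multiplicative_automorphism_def algebra_automorphism_def)
  have diag: "\<psi> a = a" if "a \<in> diagonal_part" for a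
  proof -
    interpret module_hom "inc_scale scale" "inc_scale scale" \<psi>
      using \<psi> by (simp add: multiplicative_automorphism_def algebra_automorphism_def)
    obtain \<beta> where \<beta>: "\<And>a c. a \<in> diagonal_part \<Longrightarrow> c \<in> strict_part \<Longrightarrow> \<psi> (a + c) = a + \<beta> c"
      using \<psi> unfolding multiplicative_automorphism_def by blast
    have 0: "0 \<in> diagonal_part" "0 \<in> strict_part"
      by (simp_all add: diagonal_part_def strict_part_def zero_incidence.rep_eq)
    have "\<beta> 0 = 0" using \<beta> [OF 0] zero by simp
    then show ?thesis using \<beta> [OF that 0(2)] by simp
  qed
  have single: "\<psi> (inc_single z z r) = inc_single z z r" for z r
    by (rule diag) (auto simp: diagonal_part_def inc_single.rep_eq)
  define c where "c = entry (\<psi> (inc_single x y 1)) x y"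
  have corner: "inc_single x x 1 * inc_single x y 1 * inc_single y y 1 = inc_single x y (1::'r)"
    using xy by (simp add: inc_single_mult)
  have c: "\<psi> (inc_single x y 1) = inc_single x y c"
  proof -
    have "\<psi> (inc_single x y 1)
        = inc_single x x 1 * \<psi> (inc_single x y 1) * inc_single y y 1"
      by (subst corner [symmetric]) (simp only: mult single)
    also have "\<dots> = inc_single x y c"
      using xy by (simp only: inc_single_corner c_def)
    finally show ?thesis .
  qed
  have left: "\<psi> (inc_single x y r) = inc_single x y (r * c)" for r
  proof -
    have "\<psi> (inc_single x y r) = \<psi> (inc_single x x r * inc_single x y 1)"
      using xy by (simp add: inc_single_mult)
    also have "\<dots> = inc_single x x r * inc_single x y c"
      by (simp only: mult single c)
    also have "\<dots> = inc_single x y (r * c)"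
      using xy by (simp add: inc_single_mult)
    finally show ?thesis .
  qed
  have right: "\<psi> (inc_single x y r) = inc_single x y (c * r)" for r
  proof -
    have "\<psi> (inc_single x y r) = \<psi> (inc_single x y 1 * inc_single y y r)"
      using xy by (simp add: inc_single_mult)
    also have "\<dots> = inc_single x y c * inc_single y y r"
      by (simp only: mult single c)
    also have "\<dots> = inc_single x y (c * r)"
      using xy by (simp add: inc_single_mult)
    finally show ?thesis .
  qed
  have central: "central_elt c"
    unfolding central_elt_def
  proof
    fix r
    have "inc_single x y (c * r) = inc_single x y (r * c)"
      using left [of r] right [of r] by simp
    then show "c * r = r * c" using xy by (simp only: inc_single_cancel)
  qed
  obtain g where g: "\<psi> g = inc_single x y 1"
    using bij_is_surj [OF bij] by (metis surj_def)
  have "\<psi> (inc_single x x 1 * g * inc_single y y 1) = inc_single x y 1"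
    using xy by (simp add: mult single g inc_single_mult)
  then have "inc_single x y (c * entry g x y) = inc_single x y 1"
    using xy by (simp add: inc_single_corner right)
  then have "c * entry g x y = 1" using xy by (simp add: inc_single_cancel)
  then have "invertible_elt c"
    using central by (auto simp: invertible_elt_def inverse_pair_def central_elt_def)
  moreover have "c' = c" if "\<forall>r. \<psi> (inc_single x y r) = inc_single x y (c' * r)" for c'
    using that [rule_format, of 1] right [of 1] xy by (simp add: inc_single_cancel)
  ultimately show ?thesis
    using central right by (intro ex1I [of _ c] conjI allI) simp_all
qed

definition edge_weight ::
  "(('x :: {finite, order}, 'r :: ring_1) incidence \<Rightarrow> ('x, 'r) incidence) \<Rightarrow> 'x \<Rightarrow> 'x \<Rightarrow> 'r" where
  "edge_weight \<psi> x y = (if x < y then mult_coeff \<psi> x y else ring_inverse (mult_coeff \<psi> y x))"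

definition walk_weight ::
  "(('x :: {finite, order}, 'r :: ring_1) incidence \<Rightarrow> ('x, 'r) incidence) \<Rightarrow> 'x list \<Rightarrow> 'r" where
  "walk_weight \<psi> zs = prod_list (map2 (edge_weight \<psi>) zs (tl zs))"

text \<open>
  The weight of a simple cycle is the weight of an arbitrarily chosen traversal. Another choice
  can only replace it by its inverse, so \<open>cycle_weight \<psi> C = 1\<close> does not depend on the choice.
\<close>

definition cycle_weight ::
  "(('x :: {finite, order}, 'r :: ring_1) incidence \<Rightarrow> ('x, 'r) incidence) \<Rightarrow> 'x set set \<Rightarrow> 'r" where
  "cycle_weight \<psi> C =
     walk_weight \<psi> (SOME zs. cycle_traversal UNIV comparability_edges zs \<and> walk_edges zs = C)"

end

theory Submission
  imports Defs
begin

text \<open>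
  Both sides of the equivalence say that the edge weights come from a \<^emph>\<open>potential\<close>, a family
  \<open>v\<close> of central units with \<open>v y = v x * w x y\<close> along every edge.

  On the algebraic side, a multiplicative automorphism fixes the diagonal. If it is conjugation by
  an element, this element therefore commutes with every diagonal matrix, so it is itself diagonal
  with central units \<open>v x\<close> on the diagonal. Conjugation by such an element multiplies the entry
  at \<open>(x, y)\<close> by \<open>(v x)\<^sup>-\<^sup>1 * v y\<close>, whereas the given automorphism multiplies it by \<open>c\<^sub>x\<^sub>y\<close>
  (\<open>inner_iff_potential\<close>).

  On the graph side, a potential telescopes along a walk, so every closed walk has weight \<open>1\<close>.
  Conversely, every closed walk in a tree reduces to back-and-forth steps and has weight \<open>1\<close>
  (\<open>closed_walk_weight\<close>), so the weight of a walk from a fixed root inside the spanning tree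
  depends on its end only, and this gives a potential along the tree edges (\<open>tree_potential\<close>).
  Any other edge occurs exactly once in a traversal of its fundamental cycle. When
  this traversal has weight \<open>1\<close>, the relation for the one remaining edge follows from those
  for the tree edges (\<open>potential_across_edge\<close>). This argument applies to every traversal
  of the cycle, in particular to the one that \<open>cycle_weight\<close> selects.

  Weights of walks are treated in an arbitrary monoid: the edge weights keep the order of the walk,
  and factors are cancelled only at the two ends of a product or, for a closed part
  of weight \<open>1\<close>, in its interior.
\<close>

section \<open>Walks and cycles\<close>

lemma walk_glue:
  "walk V E (as @ x # bs) \<longleftrightarrow> walk V E (as @ [x]) \<and> walk V E (x # bs)"
  by (cases "as = []") (auto simp: walk_def successively_append_iff)

lemma walk_append:
  assumes "P \<noteq> []" "Q \<noteq> []"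
  shows "walk V E (P @ Q) \<longleftrightarrow> walk V E P \<and> walk V E Q \<and> {last P, hd Q} \<in> E"
  using assms by (auto simp: walk_def successively_append_iff)

lemma walk_rev: "walk V E (rev zs) \<longleftrightarrow> walk V E zs"
  by (simp add: walk_def insert_commute)

lemma walk_edges_Cons: "zs \<noteq> [] \<Longrightarrow> walk_edges (x # zs) = insert {x, hd zs} (walk_edges zs)"
  by (cases zs) (auto simp: walk_edges_def)

lemma walk_edges_conv_nth:
  "walk_edges zs = {{zs ! i, zs ! Suc i} |i. Suc i < length zs}"
  by (force simp: walk_edges_def set_zip nth_tl)

lemma walk_edges_append:
  assumes "P \<noteq> []" "Q \<noteq> []"
  shows "walk_edges (P @ Q) = insert {last P, hd Q} (walk_edges P \<union> walk_edges Q)"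
  using assms(1)
proof (induction P)
  case (Cons x P)
  then show ?case
    using assms(2) by (cases "P = []") (auto simp: walk_edges_Cons walk_edges_def [of "[_]"])
qed simp

lemma walk_iff_walk_edges:
  "walk V E zs \<longleftrightarrow> zs \<noteq> [] \<and> set zs \<subseteq> V \<and> walk_edges zs \<subseteq> E"
  by (auto simp: walk_def walk_edges_conv_nth successively_conv_nth)

text \<open>Whenever a vertex occurs twice, the part of the walk between the occurrences can be cut out.\<close>

lemma walk_shortcut_distinct:
  assumes "walk V E zs"
  shows "\<exists>ps. walk V E ps \<and> hd ps = hd zs \<and> last ps = last zs \<and> distinct ps"
  using assms
proof (induction zs rule: length_induct)
  case (1 zs)
  show ?case
  proof (cases "distinct zs")
    case False
    then obtain as x bs cs where zs: "zs = as @ [x] @ bs @ [x] @ cs"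
      using not_distinct_decomp by blast
    have "walk V E (as @ x # cs)"
      using "1.prems" walk_glue [of V E as x "bs @ x # cs"] walk_glue [of V E "x # bs" x cs]
        walk_glue [of V E as x cs] by (simp add: zs)
    moreover have "hd (as @ x # cs) = hd zs" "last (as @ x # cs) = last zs"
      "length (as @ x # cs) < length zs"
      by (auto simp: zs hd_append)
    ultimately show ?thesis using "1.IH" by metis
  qed (use "1.prems" in blast)
qed

text \<open>
  An edge traversed twice would have to be traversed once in each direction, since only the first
  vertex of a traversal is repeated. The two passages would then be consecutive, making the whole
  traversal \<open>[x, y, x]\<close>; this is the case that the bound on the length excludes.
\<close>

lemma cycle_traversal_edges_distinct:
  assumes "cycle_traversal V E zs" and "i < j" and "Suc j < length zs"
  shows "{zs ! i, zs ! Suc i} \<noteq> {zs ! j, zs ! Suc j}"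
proof
  assume eq: "{zs ! i, zs ! Suc i} = {zs ! j, zs ! Suc j}"
  have zs: "zs \<noteq> []" "hd zs = last zs" "distinct (tl zs)" "length zs \<ge> 4"
    using assms(1) by (auto simp: cycle_traversal_def walk_def)
  have inj: "a = b" if "zs ! Suc a = zs ! Suc b" "Suc a < length zs" "Suc b < length zs" for a b
    using that zs(3) nth_eq_iff_index_eq [OF zs(3), of a b] by (simp add: nth_tl)
  have "zs ! Suc i \<noteq> zs ! Suc j" using inj [of i j] assms by auto
  with eq have *: "zs ! i = zs ! Suc j" "zs ! Suc i = zs ! j" by (auto simp: doubleton_eq_iff)
  from *(2) have "j = Suc i" using inj [of i "j - 1"] assms by (cases j) auto
  moreover have "i = 0"
    using *(1) inj [of "i - 1" j] assms by (cases i) auto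
  \<comment> \<open>The traversal returns to its first vertex after two steps, so it stops there.\<close>
  moreover have "zs ! 0 = zs ! Suc (length zs - 2)"
    using zs by (simp add: hd_conv_nth last_conv_nth Suc_diff_Suc numeral_2_eq_2)
  ultimately have "zs ! Suc 1 = zs ! Suc (length zs - 2)" using *(1) by (metis One_nat_def)
  then have "1 = length zs - 2" using zs(4) by (intro inj) auto
  with zs(4) show False by simp
qed

lemma cycle_traversal_split:
  assumes "cycle_traversal V E zs" and "e \<in> walk_edges zs"
  obtains P Q where "zs = P @ Q" "P \<noteq> []" "Q \<noteq> []" "{last P, hd Q} = e"
    "e \<notin> walk_edges P" "e \<notin> walk_edges Q"
proof -
  obtain i where i: "e = {zs ! i, zs ! Suc i}" "Suc i < length zs"
    using assms(2) by (auto simp: walk_edges_conv_nth)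
  show thesis
  proof
    show "zs = take (Suc i) zs @ drop (Suc i) zs" by simp
    show "take (Suc i) zs \<noteq> []" "drop (Suc i) zs \<noteq> []" using i(2) by auto
    show "{last (take (Suc i) zs), hd (drop (Suc i) zs)} = e"
      using i by (simp add: hd_drop_conv_nth take_Suc_conv_app_nth)
    show "e \<notin> walk_edges (take (Suc i) zs)"
    proof
      assume "e \<in> walk_edges (take (Suc i) zs)"
      then obtain j where "e = {zs ! j, zs ! Suc j}" "j < i"
        using i(2) by (auto simp: walk_edges_conv_nth)
      then show False using cycle_traversal_edges_distinct [OF assms(1), of j i] i by simp
    qed
    show "e \<notin> walk_edges (drop (Suc i) zs)"
    proof
      assume "e \<in> walk_edges (drop (Suc i) zs)"
      then obtain j where "e = {zs ! (Suc i + j), zs ! Suc (Suc i + j)}"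
          "Suc (Suc i + j) < length zs"
        using i(2) by (auto simp: walk_edges_conv_nth)
      then show False
        using cycle_traversal_edges_distinct [OF assms(1), of i "Suc i + j"] i by simp
    qed
  qed
qed

text \<open>
  A path in the tree from one end of the new edge to the other is closed up by this edge. The result
  has at least three vertices because the path is not the edge itself.
\<close>

lemma fundamental_cycle_exists:
  assumes conn: "connected_graph V T" and "T \<subseteq> E" and e: "{a, b} \<in> E - T" and "a \<noteq> b"
    and ab: "a \<in> V" "b \<in> V"
  shows "\<exists>C \<in> fundamental_cycles V E T. {a, b} \<in> C \<and> C \<subseteq> insert {a, b} T"
proof -
  have "joined V T b a" using conn ab by (simp add: connected_graph_def)
  then obtain ps where ps: "walk V T ps" "hd ps = b" "last ps = a" "distinct ps"
    unfolding joined_def using walk_shortcut_distinct by metis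
  have ne: "ps \<noteq> []" using ps(1) by (simp add: walk_def)
  have edges: "walk_edges (a # ps) = insert {a, b} (walk_edges ps)"
    using ne ps(2) by (simp add: walk_edges_Cons)
  have sub: "walk_edges ps \<subseteq> T" using ps(1) by (simp add: walk_iff_walk_edges)
  have "length ps \<noteq> 1" using ps(2,3) \<open>a \<noteq> b\<close> by (auto simp: length_Suc_conv)
  moreover have "length ps \<noteq> 2"
    using ps(1-3) e by (auto simp: length_Suc_conv numeral_2_eq_2 walk_def insert_commute)
  moreover have "length ps \<noteq> 0" using ne by simp
  ultimately have "length ps \<ge> 3" by linarith
  then have "length (a # ps) \<ge> 4" by simp
  moreover have "walk V E (a # ps)"
    using edges sub assms(2) e ab ps(1) by (auto simp: walk_iff_walk_edges)
  ultimately have "cycle_traversal V E (a # ps)"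
    using ps ne by (simp add: cycle_traversal_def)
  then have "simple_cycle V E (walk_edges (a # ps))" unfolding simple_cycle_def by blast
  then show ?thesis
    using edges sub e unfolding fundamental_cycles_def by (intro bexI [of _ "walk_edges (a # ps)"]) auto
qed


section \<open>Weights of walks and potentials\<close>

text \<open>
  The weight of a walk in a general graph; \<open>walk_weight \<psi>\<close> is the instance \<open>w = edge_weight \<psi>\<close>.
\<close>

definition path_weight :: "('v \<Rightarrow> 'v \<Rightarrow> 'm :: monoid_mult) \<Rightarrow> 'v list \<Rightarrow> 'm" where
  "path_weight w zs = prod_list (map2 w zs (tl zs))"

lemma path_weight_simps [simp]:
  "path_weight w [x] = 1"
  "path_weight w (x # y # zs) = w x y * path_weight w (y # zs)"
  by (simp_all add: path_weight_def)

lemma path_weight_append: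
  assumes "P \<noteq> []" "Q \<noteq> []"
  shows "path_weight w (P @ Q) = path_weight w P * w (last P) (hd Q) * path_weight w Q"
  using assms(1)
proof (induction P)
  case (Cons x P)
  then show ?case
    using assms(2) by (cases P; cases Q) (auto simp: mult.assoc)
qed simp

lemma path_weight_glue:
  "path_weight w (as @ x # bs) = path_weight w (as @ [x]) * path_weight w (x # bs)"
  by (cases "as = []") (simp_all add: path_weight_append mult.assoc)

lemma potential_telescopes:
  assumes "walk V E zs" and "\<And>x y. {x, y} \<in> E \<Longrightarrow> v y = v x * w x y"
  shows "v (last zs) = v (hd zs) * path_weight w zs"
  using assms(1)
proof (induction zs rule: induct_list012)
  case (3 x y zs)
  then have "v (last (y # zs)) = v y * path_weight w (y # zs)" "{x, y} \<in> E"
    by (auto simp: walk_def)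
  then show ?case using assms(2) [of x y] by (simp add: mult.assoc)
qed (simp_all add: walk_def)

locale edge_weights =
  fixes E :: "'v set set" and w :: "'v \<Rightarrow> 'v \<Rightarrow> 'm :: monoid_mult"
  assumes no_loop: "{u, u} \<notin> E"
    and weight_inverse: "{u, v} \<in> E \<Longrightarrow> w u v * w v u = 1"
begin

lemma path_weight_rev:
  assumes "walk V E zs"
  shows "path_weight w zs * path_weight w (rev zs) = 1"
  using assms
proof (induction zs rule: induct_list012)
  case (3 x y zs)
  then have e: "{x, y} \<in> E" and "walk V E (y # zs)" by (auto simp: walk_def)
  with 3 have IH: "path_weight w (y # zs) * path_weight w (rev zs @ [y]) = 1" by simp
  have "path_weight w (x # y # zs) * path_weight w (rev (x # y # zs))
      = w x y * (path_weight w (y # zs) * path_weight w (rev zs @ [y])) * w y x"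
    using path_weight_append [of "rev zs @ [y]" "[x]" w] by (simp add: mult.assoc)
  then show ?case using e by (simp add: IH weight_inverse)
qed (simp_all add: walk_def)

text \<open>
  A closed walk that repeats a vertex other than its base point splits into two shorter closed walks.
  Without such a repetition it is a cycle traversal unless it has at most two steps, and
  then it is trivial or goes back and forth along an edge.
\<close>

lemma closed_walk_weight:
  assumes "\<nexists>C. simple_cycle V E C" and "walk V E zs" and "hd zs = last zs"
  shows "path_weight w zs = 1"
  using assms(2,3)
proof (induction zs rule: length_induct)
  case (1 zs)
  obtain h ys where zs: "zs = h # ys" using "1.prems" by (cases zs) (auto simp: walk_def)
  show ?case
  proof (cases "distinct ys")
    case True
    have "\<not> cycle_traversal V E zs" using assms(1) by (auto simp: simple_cycle_def)
    then have "length ys < 3" using "1.prems" True by (simp add: cycle_traversal_def zs)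
    then consider "ys = []" | a where "ys = [a]" | a b where "ys = [a, b]"
      by (cases ys; cases "tl ys"; cases "tl (tl ys)") auto
    then show ?thesis
      using "1.prems" no_loop by cases (auto simp: zs walk_def weight_inverse)
  next
    case False
    then obtain as x bs cs where ys: "ys = as @ [x] @ bs @ [x] @ cs"
      using not_distinct_decomp by blast
    have walks: "walk V E ((h # as) @ [x])" "walk V E (x # bs @ [x])" "walk V E (x # cs)"
      using "1.prems"(1) walk_glue [of V E "h # as" x "bs @ x # cs"]
        walk_glue [of V E "x # bs" x cs] by (simp_all add: zs ys)
    have inner: "path_weight w (x # bs @ [x]) = 1"
      using "1.IH" walks(2) by (simp add: zs ys)
    have "walk V E ((h # as) @ x # cs)"
      using walks walk_glue [of V E "h # as" x cs] by simp
    then have outer: "path_weight w ((h # as) @ x # cs) = 1"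
      using "1.IH" "1.prems"(2) by (simp add: zs ys)
    have "path_weight w zs
        = path_weight w ((h # as) @ [x]) * path_weight w (x # bs @ [x]) * path_weight w (x # cs)"
      using path_weight_glue [of w "h # as" x "bs @ x # cs"] path_weight_glue [of w "x # bs" x cs]
      by (simp add: zs ys mult.assoc)
    also have "\<dots> = 1"
      using outer path_weight_glue [of w "h # as" x cs] by (simp add: inner)
    finally show ?thesis .
  qed
qed

text \<open>Going along one walk and back along the other gives a closed walk.\<close>

lemma path_weight_unique:
  assumes acyc: "\<nexists>C. simple_cycle V E C"
    and P: "walk V E P" and Q: "walk V E Q" and "hd P = hd Q" "last P = last Q"
  shows "path_weight w P = path_weight w Q"
proof -
  have ne: "P \<noteq> []" "Q \<noteq> []" using P Q by (auto simp: walk_def)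
  define x where "x = last P"
  have P': "P = butlast P @ [x]" and Q': "rev Q = x # tl (rev Q)"
    using ne by (simp add: x_def, metis x_def assms(5) hd_rev list.collapse rev_is_Nil_conv)
  let ?Z = "butlast P @ x # tl (rev Q)"
  have "walk V E ?Z"
    using P Q P' Q' walk_glue [of V E "butlast P" x "tl (rev Q)"] walk_rev [of V E Q] by metis
  moreover have "hd ?Z = hd P" by (metis P' hd_append hd_append2 list.sel(1))
  moreover have "last ?Z = hd Q"
    using Q' ne by (metis last_appendR last_rev list.distinct(1))
  ultimately have "path_weight w ?Z = 1" using closed_walk_weight [OF acyc] assms(4) by metis
  then have "path_weight w P * path_weight w (rev Q) = 1"
    using P' Q' path_weight_glue [of w "butlast P" x "tl (rev Q)"] by metis
  moreover have "path_weight w (rev Q) * path_weight w Q = 1"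
    using path_weight_rev [of V "rev Q"] Q by (simp add: walk_rev)
  ultimately show ?thesis by (metis mult.assoc mult.left_neutral mult.right_neutral)
qed

text \<open>
  The value at a vertex is the weight of a walk to it from a fixed root. That it is recorded as
  the weight of a walk serves to transfer centrality and invertibility from the edge weights to the
  potential.
\<close>

lemma tree_potential:
  assumes conn: "connected_graph UNIV E" and acyc: "\<nexists>C. simple_cycle UNIV E C"
  obtains v where "\<And>x. \<exists>zs. walk UNIV E zs \<and> v x = path_weight w zs"
    and "\<And>x y. {x, y} \<in> E \<Longrightarrow> v y = v x * w x y"
proof -
  fix r :: 'v
  have "\<forall>x. \<exists>zs. walk UNIV E zs \<and> hd zs = r \<and> last zs = x"
    using conn by (simp add: connected_graph_def joined_def)
  then obtain p where p: "\<And>x. walk UNIV E (p x)" "\<And>x. hd (p x) = r" "\<And>x. last (p x) = x"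
    by metis
  have ne: "p x \<noteq> []" for x using p(1) [of x] by (simp add: walk_def)
  show thesis
  proof
    show "\<exists>zs. walk UNIV E zs \<and> path_weight w (p x) = path_weight w zs" for x
      using p(1) by blast
    fix x y assume e: "{x, y} \<in> E"
    have "walk UNIV E (p x @ [y])"
      using e p ne by (simp add: walk_append) (simp add: walk_def)
    then have "path_weight w (p y) = path_weight w (p x @ [y])"
      using path_weight_unique [OF acyc p(1), of "p x @ [y]" y] p ne by simp
    then show "path_weight w (p y) = path_weight w (p x) * w x y"
      using p ne by (simp add: path_weight_append)
  qed
qed

text \<open>
  The given edge cuts the traversal into two walks in \<open>T\<close>, along which the potential telescopes. As
  the whole traversal is closed and has weight \<open>1\<close>, the potential changes across the cut by the
  weight of the edge.
\<close>

lemma potential_across_edge: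
  assumes pot: "\<And>x y. {x, y} \<in> T \<Longrightarrow> v y = v x * w x y"
    and zs: "cycle_traversal V E zs" and weight: "path_weight w zs = 1"
    and e: "{a, b} \<in> walk_edges zs" and sub: "walk_edges zs \<subseteq> insert {a, b} T"
  shows "v b = v a * w a b"
proof -
  obtain P Q where PQ: "zs = P @ Q" "P \<noteq> []" "Q \<noteq> []" "{last P, hd Q} = {a, b}"
    "{a, b} \<notin> walk_edges P" "{a, b} \<notin> walk_edges Q"
    using cycle_traversal_split [OF zs e] .
  let ?x = "last P" and ?y = "hd Q"
  have zsE: "walk V E zs" and closed: "hd P = last Q"
    using zs PQ(1-3) by (auto simp: cycle_traversal_def)
  have QE: "walk V E Q" and eE: "{?x, ?y} \<in> E"
    using zsE PQ(1-3) by (simp_all add: walk_append)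
  have "walk_edges P \<subseteq> T" "walk_edges Q \<subseteq> T"
    using sub PQ by (auto simp: walk_edges_append)
  then have "walk V T P" "walk V T Q"
    using zsE PQ(1-3) by (simp_all add: walk_iff_walk_edges)
  then have tele: "v ?x = v (hd P) * path_weight w P" "v (last Q) = v ?y * path_weight w Q"
    using potential_telescopes [of V T _ v w] pot by blast+
  have "v ?x * w ?x ?y * path_weight w Q = v (hd P) * path_weight w zs"
    using PQ(1-3) by (simp add: tele path_weight_append mult.assoc)
  also have "\<dots> = v ?y * path_weight w Q" using tele(2) by (simp add: weight closed)
  finally have "v ?x * w ?x ?y = v ?y"
    using path_weight_rev [OF QE] by (metis mult.assoc mult.right_neutral)
  \<comment> \<open>The traversal may run through the edge in either direction, so both relations are needed.\<close>
  moreover from this have "v ?y * w ?y ?x = v ?x"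
    using weight_inverse [OF eE] by (metis mult.assoc mult.right_neutral)
  ultimately show ?thesis using PQ(4) by (auto simp: doubleton_eq_iff)
qed

end


section \<open>Multiplicative automorphisms of incidence algebras\<close>

lemma inverse_pair_ring_inverse:
  assumes "invertible_elt v"
  shows "inverse_pair (ring_inverse v) v"
proof -
  obtain u where u: "inverse_pair u v" using assms by (auto simp: invertible_elt_def)
  have "u' = u" if "inverse_pair u' v" for u'
    using u that unfolding inverse_pair_def by (metis mult.assoc mult.left_neutral mult.right_neutral)
  with u show ?thesis unfolding ring_inverse_def by (rule theI)
qed

lemma central_elt_inverse:
  assumes "inverse_pair u c" and "central_elt c"
  shows "central_elt u"
  unfolding central_elt_def
proof
  fix r
  have "u * r = u * (r * c) * u"
    using assms(1) unfolding inverse_pair_def by (metis mult.assoc mult.right_neutral)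
  also have "\<dots> = r * u"
    using assms unfolding inverse_pair_def central_elt_def by (metis mult.assoc mult.left_neutral)
  finally show "u * r = r * u" .
qed

lemma central_path_weight:
  assumes "walk V E zs" and "\<And>x y. {x, y} \<in> E \<Longrightarrow> central_elt (w x y)"
  shows "central_elt (path_weight w zs)"
  using assms(1)
proof (induction zs rule: induct_list012)
  case (3 x y zs)
  then have p: "path_weight w (y # zs) * r = r * path_weight w (y # zs)"
    and w: "w x y * r = r * w x y" for r
    using assms(2) [of x y] by (auto simp: walk_def central_elt_def)
  have "w x y * path_weight w (y # zs) * r = r * (w x y * path_weight w (y # zs))" for r
    by (metis p w mult.assoc)
  then show ?case by (simp add: central_elt_def)
qed (simp_all add: walk_def central_elt_def)

lemma mult_coeff:
  fixes \<psi> :: "('x :: {finite, order}, 'r :: ring_1) incidence \<Rightarrow> ('x, 'r) incidence"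
  assumes "multiplicative_automorphism scale \<psi>" and "x < y"
  shows "invertible_elt (mult_coeff \<psi> x y)" "central_elt (mult_coeff \<psi> x y)"
    "\<psi> (inc_single x y r) = inc_single x y (mult_coeff \<psi> x y * r)"
  using theI' [OF mult_coeff_unique_exists [OF assms]] unfolding mult_coeff_def by blast+

lemma multiplicative_automorphism_diagonal:
  assumes \<psi>: "multiplicative_automorphism scale \<psi>" and "a \<in> diagonal_part"
  shows "\<psi> a = a"
proof -
  interpret module_hom "inc_scale scale" "inc_scale scale" \<psi>
    using \<psi> by (simp add: multiplicative_automorphism_def algebra_automorphism_def)
  obtain \<beta> where \<beta>: "\<And>a c. a \<in> diagonal_part \<Longrightarrow> c \<in> strict_part \<Longrightarrow> \<psi> (a + c) = a + \<beta> c"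
    using \<psi> unfolding multiplicative_automorphism_def by blast
  have 0: "0 \<in> diagonal_part" "0 \<in> strict_part"
    by (simp_all add: diagonal_part_def strict_part_def zero_incidence.rep_eq)
  have "\<beta> 0 = 0" using \<beta> [OF 0] zero by simp
  then show ?thesis using \<beta> [OF assms(2) 0(2)] by simp
qed

lemma inc_single_diagonal: "inc_single z z r \<in> diagonal_part"
  by (auto simp: diagonal_part_def inc_single.rep_eq)

text \<open>
  Corners by diagonal idempotents isolate single entries, and the automorphism commutes with
  taking corners because it fixes these idempotents.
\<close>

lemma multiplicative_automorphism_entry:
  fixes \<psi> :: "('x :: {finite, order}, 'r :: ring_1) incidence \<Rightarrow> ('x, 'r) incidence"
  assumes \<psi>: "multiplicative_automorphism scale \<psi>" and "x \<le> y"
  shows "entry (\<psi> a) x y = (if x = y then 1 else mult_coeff \<psi> x y) * entry a x y"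
proof -
  have mult: "\<psi> (a * b) = \<psi> a * \<psi> b" for a b
    using \<psi> by (auto simp: multiplicative_automorphism_def algebra_automorphism_def)
  note single = multiplicative_automorphism_diagonal [OF \<psi> inc_single_diagonal]
  have "inc_single x y (entry (\<psi> a) x y) = inc_single x x 1 * \<psi> a * inc_single y y 1"
    using \<open>x \<le> y\<close> by (simp add: inc_single_corner)
  also have "\<dots> = \<psi> (inc_single x x 1 * a * inc_single y y 1)"
    by (simp add: mult single)
  also have "\<dots> = \<psi> (inc_single x y (entry a x y))"
    using \<open>x \<le> y\<close> by (simp add: inc_single_corner)
  also have "\<dots> = inc_single x y ((if x = y then 1 else mult_coeff \<psi> x y) * entry a x y)"
    using \<open>x \<le> y\<close> mult_coeff(3) [OF \<psi>, of x y] single by (auto simp: less_le)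
  finally show ?thesis using \<open>x \<le> y\<close> by (simp add: inc_single_cancel)
qed

lift_definition diag :: "('x :: order \<Rightarrow> 'r) \<Rightarrow> ('x, 'r :: zero) incidence"
  is "\<lambda>v x y. if x = y then v x else 0"
  by auto

lemma entry_diag_mult:
  fixes a :: "('x :: {finite, order}, 'r :: ring_1) incidence"
  shows "entry (diag v * a) x y = v x * entry a x y"
    and "entry (a * diag v) x y = entry a x y * v y"
  by (simp_all add: entry_times_UNIV diag.rep_eq if_distrib [of "\<lambda>t. t * _"]
      if_distrib [of "\<lambda>t. _ * t"] cong: if_cong)

text \<open>
  Commuting with the idempotents \<open>e\<^sub>x\<^sub>x\<close> kills the entries off the diagonal; commuting with
  \<open>r e\<^sub>x\<^sub>x\<close> for all \<open>r\<close> makes those on the diagonal central.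
\<close>

lemma commutes_with_diagonal:
  fixes a :: "('x :: {finite, order}, 'r :: ring_1) incidence"
  assumes "\<And>x r. inc_single x x r * a = a * inc_single x x r"
  shows "a = diag (\<lambda>x. entry a x x)" and "central_elt (entry a x x)"
proof -
  have l: "entry (inc_single z z r * a) x y = (if x = z then r * entry a x y else 0)" for z r x y
    by (simp add: entry_times_UNIV inc_single.rep_eq if_distrib [of "\<lambda>t. t * _"] cong: if_cong)
  have r: "entry (a * inc_single z z r) x y = (if y = z then entry a x y * r else 0)" for z r x y
    by (simp add: entry_times_UNIV inc_single.rep_eq if_distrib [of "\<lambda>t. _ * t"] cong: if_cong)
  have "entry a x y = 0" if "x \<noteq> y" for x y
    using arg_cong [OF assms [of x 1], of "\<lambda>f. entry f x y"] that by (simp add: l r)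
  then show "a = diag (\<lambda>x. entry a x x)" by (auto intro!: incidence_eqI simp: diag.rep_eq)
  show "central_elt (entry a x x)"
    unfolding central_elt_def
  proof
    fix s show "entry a x x * s = s * entry a x x"
      using arg_cong [OF assms [of x s], of "\<lambda>f. entry f x x"] by (simp add: l r)
  qed
qed

text \<open>
  The elements implementing the automorphism by conjugation are exactly the diagonal elements
  \<open>diag v\<close> for the potentials \<open>v\<close>.
\<close>

lemma inner_iff_potential:
  fixes \<psi> :: "('x :: {finite, order}, 'r :: ring_1) incidence \<Rightarrow> ('x, 'r) incidence"
  assumes \<psi>: "multiplicative_automorphism scale \<psi>"
  shows "inner_automorphism \<psi> \<longleftrightarrow>
    (\<exists>v. (\<forall>x. invertible_elt (v x) \<and> central_elt (v x)) \<and>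
         (\<forall>x y. x < y \<longrightarrow> v y = v x * mult_coeff \<psi> x y))"
proof
  assume "inner_automorphism \<psi>"
  then obtain a where inv: "invertible_elt a" and a: "\<And>b. \<psi> b = ring_inverse a * b * a"
    by (auto simp: inner_automorphism_def)
  define u where "u = ring_inverse a"
  have u: "a * u = 1" "u * a = 1"
    using inverse_pair_ring_inverse [OF inv] by (auto simp: u_def inverse_pair_def)
  have comm: "a * \<psi> b = b * a" for b
    using u by (simp add: a mult.assoc [symmetric] flip: u_def)
  define v where "v x = entry a x x" for x
  have fixed: "inc_single x x r * a = a * inc_single x x r" for x r
    using comm [of "inc_single x x r"] multiplicative_automorphism_diagonal [OF \<psi> inc_single_diagonal]
    by simp
  have av: "a = diag v" and central: "central_elt (v x)" for x
    using commutes_with_diagonal [OF fixed] by (simp_all add: v_def [abs_def])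
  have "inverse_pair (entry u x x) (v x)" for x
    using arg_cong [OF u(1), of "\<lambda>f. entry f x x"] arg_cong [OF u(2), of "\<lambda>f. entry f x x"]
    by (simp add: av entry_diag_mult one_incidence.rep_eq inverse_pair_def)
  moreover have "v y = v x * mult_coeff \<psi> x y" if "x < y" for x y
    using arg_cong [OF comm [of "inc_single x y 1"], of "\<lambda>f. entry f x y"] that less_imp_le [OF that]
    by (simp add: mult_coeff(3) [OF \<psi> that] av entry_diag_mult inc_single.rep_eq)
  ultimately show "\<exists>v. (\<forall>x. invertible_elt (v x) \<and> central_elt (v x)) \<and>
         (\<forall>x y. x < y \<longrightarrow> v y = v x * mult_coeff \<psi> x y)"
    using central unfolding invertible_elt_def by (intro exI [of _ v]) blast
next
  assume "\<exists>v. (\<forall>x. invertible_elt (v x) \<and> central_elt (v x)) \<and>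
         (\<forall>x y. x < y \<longrightarrow> v y = v x * mult_coeff \<psi> x y)"
  then obtain v where inv: "\<And>x. invertible_elt (v x)" and central: "\<And>x. central_elt (v x)"
    and pot: "\<And>x y. x < y \<Longrightarrow> v y = v x * mult_coeff \<psi> x y"
    by blast
  define u where "u x = ring_inverse (v x)" for x
  have u: "u x * v x = 1" "v x * u x = 1" for x
    using inverse_pair_ring_inverse [OF inv] by (auto simp: u_def inverse_pair_def)
  have "inverse_pair (diag u) (diag v)"
    by (auto simp: inverse_pair_def one_incidence.rep_eq u entry_diag_mult diag.rep_eq
        intro!: incidence_eqI)
  then have D: "invertible_elt (diag v)" by (auto simp: invertible_elt_def)
  have comm: "diag v * \<psi> a = a * diag v" for a
  proof (rule incidence_eqI)
    fix x y :: 'x assume xy: "x \<le> y"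
    have "v y = v x * (if x = y then 1 else mult_coeff \<psi> x y)"
      using pot [of x y] xy by (auto simp: less_le)
    then have "v x * entry (\<psi> a) x y = v y * entry a x y"
      by (simp add: multiplicative_automorphism_entry [OF \<psi> xy] mult.assoc)
    then show "entry (diag v * \<psi> a) x y = entry (a * diag v) x y"
      using central by (simp add: entry_diag_mult central_elt_def)
  qed
  have "\<psi> a = ring_inverse (diag v) * a * diag v" for a
    using inverse_pair_ring_inverse [OF D] comm [of a]
    unfolding inverse_pair_def by (metis mult.assoc mult.left_neutral)
  then show "inner_automorphism \<psi>" using D by (auto simp: inner_automorphism_def)
qed

lemma edge_weight_central:
  assumes "multiplicative_automorphism scale \<psi>" and "{x, y} \<in> comparability_edges"
  shows "central_elt (edge_weight \<psi> x y)"
proof -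
  from assms(2) have "x < y \<or> y < x" by (auto simp: comparability_edges_def doubleton_eq_iff)
  then show ?thesis
    using mult_coeff(1,2) [OF assms(1)]
    by (auto simp: edge_weight_def intro!: central_elt_inverse [OF inverse_pair_ring_inverse])
qed

lemma edge_weights_mult_automorphism:
  assumes "multiplicative_automorphism scale \<psi>"
  shows "edge_weights comparability_edges (edge_weight \<psi>)"
proof
  show "{u, u} \<notin> comparability_edges" for u
    by (auto simp: comparability_edges_def doubleton_eq_iff)
  show "edge_weight \<psi> u v * edge_weight \<psi> v u = 1" if "{u, v} \<in> comparability_edges" for u v
    using that inverse_pair_ring_inverse [OF mult_coeff(1) [OF assms]]
    by (auto simp: edge_weight_def comparability_edges_def doubleton_eq_iff inverse_pair_def)
qed

lemma cycle_weight_traversal: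
  assumes "simple_cycle UNIV comparability_edges C"
  obtains zs where "cycle_traversal UNIV comparability_edges zs" "walk_edges zs = C"
    "cycle_weight \<psi> C = path_weight (edge_weight \<psi>) zs"
proof -
  have "\<exists>zs. cycle_traversal UNIV comparability_edges zs \<and> walk_edges zs = C"
    using assms by (simp add: simple_cycle_def)
  from someI_ex [OF this] show thesis
    using that unfolding cycle_weight_def walk_weight_def path_weight_def by blast
qed


section \<open>Inner multiplicative automorphisms and fundamental cycles\<close>

theorem corollary3p10:
  fixes scale :: "'k :: comm_ring_1 \<Rightarrow> 'r :: ring_1 \<Rightarrow> 'r"
    and T :: "'x :: {finite, order} set set"
    and C :: "nat \<Rightarrow> 'x set set"
    and k :: nat
    and \<psi> :: "('x, 'r) incidence \<Rightarrow> ('x, 'r) incidence"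
  assumes "K_algebra scale"
    and "connected_graph (UNIV :: 'x set) comparability_edges"
    and "spanning_tree UNIV comparability_edges T"
    and "k = cyclomatic_number (UNIV :: 'x set) comparability_edges"
    and "bij_betw C {1..k} (fundamental_cycles UNIV comparability_edges T)"
    and "multiplicative_automorphism scale \<psi>"
  shows "inner_automorphism \<psi> \<longleftrightarrow> (\<forall>i \<in> {1..k}. cycle_weight \<psi> (C i) = 1)"
proof -
  let ?E = "comparability_edges :: 'x set set"
  let ?w = "edge_weight \<psi>"
  note \<psi> = assms(6)
  have T: "T \<subseteq> ?E" "connected_graph UNIV T" "\<nexists>C. simple_cycle UNIV T C"
    using assms(3) by (auto simp: spanning_tree_def)
  interpret E: edge_weights ?E ?w by (rule edge_weights_mult_automorphism [OF \<psi>])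
  interpret T: edge_weights T ?w
    using T(1) E.no_loop E.weight_inverse by unfold_locales auto
  have "inner_automorphism \<psi> \<longleftrightarrow>
      (\<forall>C \<in> fundamental_cycles UNIV ?E T. cycle_weight \<psi> C = 1)"
    unfolding inner_iff_potential [OF \<psi>]
  proof (intro iffI ballI)
    fix C
    assume "\<exists>v. (\<forall>x. invertible_elt (v x) \<and> central_elt (v x)) \<and>
         (\<forall>x y. x < y \<longrightarrow> v y = v x * mult_coeff \<psi> x y)"
    then obtain v where inv: "\<And>x. invertible_elt (v x)"
      and "\<And>x y. x < y \<Longrightarrow> v y = v x * mult_coeff \<psi> x y"
      by blast
    then have up: "v y = v x * ?w x y" if "x < y" for x y
      using that by (simp add: edge_weight_def)
    have down: "v x = v y * ?w y x" if "x < y" for x y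
    proof -
      have "?w x y * ?w y x = 1"
        using that by (intro E.weight_inverse) (auto simp: comparability_edges_def)
      then show ?thesis using up [OF that] by (simp add: mult.assoc)
    qed
    have pot: "v y = v x * ?w x y" if "{x, y} \<in> ?E" for x y
      using that up down by (auto simp: comparability_edges_def doubleton_eq_iff)
    assume "C \<in> fundamental_cycles UNIV ?E T"
    then have "simple_cycle UNIV ?E C" by (simp add: fundamental_cycles_def)
    then obtain zs where zs: "cycle_traversal UNIV ?E zs" "cycle_weight \<psi> C = path_weight ?w zs"
      using cycle_weight_traversal by blast
    then have "v (last zs) = v (last zs) * path_weight ?w zs"
      using potential_telescopes [of UNIV ?E zs v ?w] pot by (simp add: cycle_traversal_def)
    then have "path_weight ?w zs = 1"
      using inverse_pair_ring_inverse [OF inv [of "last zs"]]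
      unfolding inverse_pair_def by (metis mult.assoc mult.left_neutral)
    then show "cycle_weight \<psi> C = 1" using zs(2) by simp
  next
    assume cyc: "\<forall>C \<in> fundamental_cycles UNIV ?E T. cycle_weight \<psi> C = 1"
    obtain v where v: "\<And>x. \<exists>zs. walk UNIV T zs \<and> v x = path_weight ?w zs"
      and potT: "\<And>x y. {x, y} \<in> T \<Longrightarrow> v y = v x * ?w x y"
      using T.tree_potential [OF T(2,3)] by blast
    have unit: "invertible_elt (v x) \<and> central_elt (v x)" for x
    proof -
      obtain zs where zs: "walk UNIV T zs" "v x = path_weight ?w zs" using v by blast
      have "inverse_pair (path_weight ?w (rev zs)) (v x)"
        using T.path_weight_rev [OF zs(1)] T.path_weight_rev [of UNIV "rev zs"] zs
        by (simp add: inverse_pair_def walk_rev)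
      moreover have "central_elt (v x)"
        using central_path_weight [OF zs(1), of ?w] edge_weight_central [OF \<psi>] T(1) zs(2) by auto
      ultimately show ?thesis by (auto simp: invertible_elt_def)
    qed
    have pot: "v y = v x * ?w x y" if xy: "x < y" for x y
    proof (cases "{x, y} \<in> T")
      case False
      have "{x, y} \<in> ?E" using xy by (auto simp: comparability_edges_def)
      then obtain C where C: "C \<in> fundamental_cycles UNIV ?E T" "{x, y} \<in> C" "C \<subseteq> insert {x, y} T"
        using fundamental_cycle_exists [OF T(2,1), of x y] False xy by auto
      then have "simple_cycle UNIV ?E C" by (simp add: fundamental_cycles_def)
      then obtain zs where "cycle_traversal UNIV ?E zs" "walk_edges zs = C"
          "cycle_weight \<psi> C = path_weight ?w zs"
        using cycle_weight_traversal by blast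
      then show ?thesis
        using E.potential_across_edge [of T v UNIV zs x y] potT C cyc by auto
    qed (simp add: potT)
    then show "\<exists>v. (\<forall>x. invertible_elt (v x) \<and> central_elt (v x)) \<and>
         (\<forall>x y. x < y \<longrightarrow> v y = v x * mult_coeff \<psi> x y)"
      using unit by (intro exI [of _ v]) (auto simp: edge_weight_def)
  qed
  also have "fundamental_cycles UNIV ?E T = C ` {1..k}"
    using assms(5) by (simp add: bij_betw_def)
  finally show ?thesis by simp
qed

end
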